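(* Suppose that $Q_{T,\lambda}(\Delta)$ is invertible, that $ERC_{T,\lambda}(\Delta)>0$, and that $$\gamma \ \ge\ \gamma^*_{T,\lambda}(\Delta) := \frac{\|{A_{(T\cup\Delta)^c}}'(y-A\,c_{T,\lambda}(\Delta))\|_\infty}{ERC_{T,\lambda}(\Delta)} .$$ Then: (1) $L$ has a unique minimizer $\hat x$ over $\mathbb{R}^m$. (2) $\hat x = d_{T,\lambda}(\Delta)$, and thus $\hat x$ is supported on $T\cup\Delta$. (3) $$\|x-\hat x\|_2 \le \gamma\sqrt{|\Delta|}\, f_1(\Delta) + \lambda f_2(\Delta)\|x_T-\hat\mu_T\|_2 + f_3(\Delta)\|w\|_2,$$ where $$f_1(\Delta) = \sqrt{\|({A_T}'A_T+\lambda I_T)^{-1}{A_T}'A_\Delta P_{T,\lambda}(\Delta)\|_2^2+\|P_{T,\lambda}(\Delta)\|_2^2},$$ $$f_2(\Delta) = \|Q_{T,\lambda}(\Delta)^{-1}\|_2,\qquad f_3(\Delta) = \|Q_{T,\lambda}(\Delta)^{-1}{A_{T\cup\Delta}}'\|_2 .$$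
   Context: Let $n<m$ be positive integers, $A\in\mathbb{R}^{n\times m}$, $x\in\mathbb{R}^m$ with support $N=\{i:x_i\ne0\}$, $w\in\mathbb{R}^n$ and $y=Ax+w$. Let $T\subseteq\{1,\dots,m\}$ and $\Delta=N\setminus T$. Let $\hat\mu\in\mathbb{R}^m$ with $\hat\mu_i=0$ for $i\notin T$. Let $\lambda\ge0$ and $\gamma$ be real (the condition on $\gamma$ in the claim forces $\gamma\ge0$). Notation: $'$ is transpose; $b_S$ is the subvector of $b$ indexed by $S$; $A_S$ is the submatrix of columns of $A$ indexed by $S$, $A_\omega$ a single column; $S^c$ is the complement in $\{1,\dots,m\}$; $\|\cdot\|_2$ of a matrix is the spectral (operator) norm; $I_T$ is the $|T|\times|T|$ identity. A vector is "supported on" a set if its nonzero entries all have indices in that set. Maxima over empty sets and norms of empty vectors or matrices are $0$; an empty matrix counts as invertible. Define $$L(b)=\gamma\|b_{T^c}\|_1+L_1(b),\qquad L_1(b)=\tfrac12\|y-Ab\|_2^2+\tfrac12\lambda\|b_T-\hat\mu_T\|_2^2 .$$ For $S\subseteq\Delta$ (rows and columns ordered with $T$ first, then $S$): $$Q_{T,\lambda}(S)={A_{T\cup S}}'A_{T\cup S}+\lambda\begin{bmatrix}I_T&0\\0&0\end{bmatrix},\quad M_{T,\lambda}=I-A_T({A_T}'A_T+\lambda I_T)^{-1}{A_T}',\quad P_{T,\lambda}(S)=({A_S}'M_{T,\lambda}A_S)^{-1},$$ $$ERC_{T,\lambda}(S)=1-\max_{\omega\notin T\cup S}\|P_{T,\lambda}(S){A_S}'M_{T,\lambda}A_\omega\|_1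 .$$ The inverses in $M_{T,\lambda}$ and $P_{T,\lambda}(S)$ exist when $Q_{T,\lambda}(S)$ is invertible. When $Q_{T,\lambda}(S)$ is invertible, $d_{T,\lambda}(S)$ and $c_{T,\lambda}(S)$ denote the unique minimizers of $L$ and of $L_1$, respectively, over vectors $b\in\mathbb{R}^m$ with $b_{(T\cup S)^c}=0$.
   Formalization: Uniqueness of the minimizer of L in (1) is asserted only for γ > 0, since it can fail when γ = γ* = 0 (e.g. x = 0, w = 0, T = ∅, λ = 0); that d is a minimizer, the support claim and the error bound are asserted for every admissible γ, including 0. *)

theory Defs
  imports "HOL-Analysis.Analysis"
begin

(* Subvectors, submatrices and index sets.
   'm labels the columns of A and 'n its rows.  A vector indexed by a set S, and a matrix whose
   rows or columns are indexed by S, keep their original labels and are padded with zeros outside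
   S.  Padding changes neither products nor sums nor any of the norms below, and it makes norms of
   empty vectors and matrices 0.  Entries are addressed by label, so the order in which the
   elements of T and S are listed (a simultaneous permutation of rows and columns) plays no role. *)

definition subvec :: "'m set \<Rightarrow> real^'m \<Rightarrow> real^'m" where
  "subvec S b = (\<chi> i. if i \<in> S then b $ i else 0)"

definition subcols :: "real^'m^'n \<Rightarrow> 'm set \<Rightarrow> real^'m^'n" where
  "subcols A S = (\<chi> i j. if j \<in> S then A $ i $ j else 0)"

definition id_mat :: "'m set \<Rightarrow> real^'m^'m" where
  "id_mat S = (\<chi> i j. if i = j \<and> i \<in> S then 1 else 0)"

definition vsupp :: "real^'m \<Rightarrow> 'm set" where
  "vsupp b = {i. b $ i \<noteq> 0}"

(* The inverse of a matrix with index set S \<times> S is again a matrix with index set S \<times> S, and the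
   unit is id_mat S.  For S = {} the zero matrix is the inverse; for S = UNIV this is the usual
   notion. *)

definition is_inverse_on :: "'m set \<Rightarrow> real^'m^'m \<Rightarrow> real^'m^'m \<Rightarrow> bool" where
  "is_inverse_on S M B \<longleftrightarrow>
     (\<forall>i j. B $ i $ j \<noteq> 0 \<longrightarrow> i \<in> S \<and> j \<in> S) \<and> M ** B = id_mat S \<and> B ** M = id_mat S"

definition invertible_on :: "'m set \<Rightarrow> real^'m^'m \<Rightarrow> bool" where
  "invertible_on S M \<longleftrightarrow> (\<exists>B. is_inverse_on S M B)"

definition inverse_on :: "'m set \<Rightarrow> real^'m^'m \<Rightarrow> real^'m^'m" where
  "inverse_on S M = (THE B. is_inverse_on S M B)"

definition norm1 :: "real^'m \<Rightarrow> real" where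
  "norm1 b = (\<Sum>i\<in>UNIV. \<bar>b $ i\<bar>)"

definition spec_norm :: "real^'a^'b \<Rightarrow> real" where
  "spec_norm M = onorm ((*v) M)"

definition max0 :: "real set \<Rightarrow> real" where
  "max0 F = (if F = {} then 0 else Max F)"

definition L1_fun :: "real^'m^'n \<Rightarrow> real^'n \<Rightarrow> 'm set \<Rightarrow> real \<Rightarrow> real^'m \<Rightarrow> real^'m \<Rightarrow> real" where
  "L1_fun A y T lam mu b =
     1 / 2 * (norm (y - A *v b))\<^sup>2 + 1 / 2 * lam * (norm (subvec T b - subvec T mu))\<^sup>2"

definition L_fun ::
    "real^'m^'n \<Rightarrow> real^'n \<Rightarrow> 'm set \<Rightarrow> real \<Rightarrow> real^'m \<Rightarrow> real \<Rightarrow> real^'m \<Rightarrow> real" where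
  "L_fun A y T lam mu gam b = gam * norm1 (subvec (- T) b) + L1_fun A y T lam mu b"

definition G_mat :: "real^'m^'n \<Rightarrow> 'm set \<Rightarrow> real \<Rightarrow> real^'m^'m" where
  "G_mat A T lam = transpose (subcols A T) ** subcols A T + lam *\<^sub>R id_mat T"

(* The padded matrix lam *\<^sub>R id_mat T is the block matrix with blocks lam * I_T, 0, 0, 0. *)
definition Q_mat :: "real^'m^'n \<Rightarrow> 'm set \<Rightarrow> real \<Rightarrow> 'm set \<Rightarrow> real^'m^'m" where
  "Q_mat A T lam S =
     transpose (subcols A (T \<union> S)) ** subcols A (T \<union> S) + lam *\<^sub>R id_mat T"

definition M_mat :: "real^'m^'n \<Rightarrow> 'm set \<Rightarrow> real \<Rightarrow> real^'n^'n" where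
  "M_mat A T lam =
     mat 1 - subcols A T ** inverse_on T (G_mat A T lam) ** transpose (subcols A T)"

definition P_mat :: "real^'m^'n \<Rightarrow> 'm set \<Rightarrow> real \<Rightarrow> 'm set \<Rightarrow> real^'m^'m" where
  "P_mat A T lam S =
     inverse_on S (transpose (subcols A S) ** M_mat A T lam ** subcols A S)"

definition ERC :: "real^'m^'n \<Rightarrow> 'm set \<Rightarrow> real \<Rightarrow> 'm set \<Rightarrow> real" where
  "ERC A T lam S =
     1 - max0 ((\<lambda>\<omega>. norm1 ((P_mat A T lam S ** transpose (subcols A S) ** M_mat A T lam)
                            *v column \<omega> A)) ` (- (T \<union> S)))"

definition d_min ::
    "real^'m^'n \<Rightarrow> real^'n \<Rightarrow> 'm set \<Rightarrow> real \<Rightarrow> real^'m \<Rightarrow> real \<Rightarrow> 'm set \<Rightarrow> real^'m" where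
  "d_min A y T lam mu gam S =
     (THE b. is_arg_min (L_fun A y T lam mu gam) (\<lambda>b. vsupp b \<subseteq> T \<union> S) b)"

definition c_min ::
    "real^'m^'n \<Rightarrow> real^'n \<Rightarrow> 'm set \<Rightarrow> real \<Rightarrow> real^'m \<Rightarrow> 'm set \<Rightarrow> real^'m" where
  "c_min A y T lam mu S =
     (THE b. is_arg_min (L1_fun A y T lam mu) (\<lambda>b. vsupp b \<subseteq> T \<union> S) b)"

definition gamma_star ::
    "real^'m^'n \<Rightarrow> real^'n \<Rightarrow> 'm set \<Rightarrow> real \<Rightarrow> real^'m \<Rightarrow> 'm set \<Rightarrow> real" where
  "gamma_star A y T lam mu S =
     infnorm (transpose (subcols A (- (T \<union> S))) *v (y - A *v c_min A y T lam mu S))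
       / ERC A T lam S"

definition f1 :: "real^'m^'n \<Rightarrow> 'm set \<Rightarrow> real \<Rightarrow> 'm set \<Rightarrow> real" where
  "f1 A T lam S =
     sqrt ((spec_norm (inverse_on T (G_mat A T lam) ** transpose (subcols A T)
                         ** subcols A S ** P_mat A T lam S))\<^sup>2
           + (spec_norm (P_mat A T lam S))\<^sup>2)"

definition f2 :: "real^'m^'n \<Rightarrow> 'm set \<Rightarrow> real \<Rightarrow> 'm set \<Rightarrow> real" where
  "f2 A T lam S = spec_norm (inverse_on (T \<union> S) (Q_mat A T lam S))"

definition f3 :: "real^'m^'n \<Rightarrow> 'm set \<Rightarrow> real \<Rightarrow> 'm set \<Rightarrow> real" where
  "f3 A T lam S =
     spec_norm (inverse_on (T \<union> S) (Q_mat A T lam S) ** transpose (subcols A (T \<union> S)))"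

(* Uniqueness of the unconstrained minimizer can fail when gam = gamma_star = 0, even though all
   the other hypotheses hold: with x = w = 0 and T = {} the objective is constant on the kernel
   of A, which is nontrivial as A has more columns than rows. *)
lemma uniqueness_fails_at_zero:
  fixes A :: "real^'m^'n"
  assumes "CARD('n) < CARD('m)"
  shows "invertible_on ({} \<union> {}) (Q_mat A {} 0 {})"
    and "ERC A {} 0 {} > 0"
    and "0 \<ge> gamma_star A (A *v 0 + 0) {} 0 0 {}"
    and "\<not> (\<exists>!b. is_arg_min (L_fun A (A *v 0 + 0) {} 0 0 0) (\<lambda>_. True) b)"
proof -
  have sc: "subcols A {} = 0"
    by (simp add: subcols_def vec_eq_iff)
  have id0: "id_mat {} = (0 :: real^'m^'m)"
    by (simp add: id_mat_def vec_eq_iff)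
  have inv0: "inverse_on {} M = 0" if "M = 0" for M :: "real^'m^'m"
    unfolding inverse_on_def
    by (rule the_equality) (auto simp: is_inverse_on_def id0 that vec_eq_iff)
  have t0: "transpose (0 :: real^'m^'n) = 0"
    by (simp add: transpose_def vec_eq_iff)
  show "invertible_on ({} \<union> {}) (Q_mat A {} 0 {})"
    unfolding invertible_on_def is_inverse_on_def
    by (rule exI[of _ 0]) (simp add: Q_mat_def sc id0 t0)
  have P0: "P_mat A {} 0 {} = 0"
    unfolding P_mat_def by (rule inv0) (simp add: sc)
  have "max0 ((\<lambda>\<omega>. norm1 ((P_mat A {} 0 {} ** transpose (subcols A {}) ** M_mat A {} 0)
                            *v column \<omega> A)) ` (- ({} \<union> {}))) = 0"
    by (simp add: max0_def P0 norm1_def)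
  then show "ERC A {} 0 {} > 0"
    by (simp add: ERC_def)
  have "c_min A 0 {} 0 0 {} = 0"
    unfolding c_min_def
    by (rule the_equality) (auto simp: is_arg_min_def vsupp_def L1_fun_def vec_eq_iff)
  then show "0 \<ge> gamma_star A (A *v 0 + 0) {} 0 0 {}"
    by (simp add: gamma_star_def infnorm_0)
  have "rank A \<noteq> CARD('m)"
    using rank_bound[of A] assms by simp
  then obtain k :: "real^'m" where k: "k \<noteq> 0" "A *v k = 0"
    using matrix_nonfull_linear_equations_eq[of A] by blast
  have "is_arg_min (L_fun A (A *v 0 + 0) {} 0 0 0) (\<lambda>_. True) b" if "A *v b = 0" for b
    by (simp add: is_arg_min_def L_fun_def L1_fun_def that)
  from this[OF k(2)] this[of 0] k(1)
  show "\<not> (\<exists>!b. is_arg_min (L_fun A (A *v 0 + 0) {} 0 0 0) (\<lambda>_. True) b)"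
    by auto
qed

end

theory Submission
  imports Defs
begin

text \<open>
  Let \<open>d\<close> and \<open>c\<close> minimize the penalized and the unpenalized objective over vectors supported on
  \<open>T \<union> S\<close>. The first order conditions say that the residual gradient \<open>v = A'(y - A d) - lam (d - mu)\<^sub>T\<close>
  vanishes on \<open>T\<close> and is bounded by \<open>gam\<close> on \<open>S\<close>, and that \<open>Q (c - d) = v\<close> there. Block elimination
  turns this into \<open>A (c - d) = M A\<^sub>S P v\<^sub>S\<close>, so for a column \<open>a\<close> outside \<open>T \<union> S\<close> the correlation
  \<open>a \<bullet> (y - A d)\<close> is at most \<open>gam ERC + gam (1 - ERC) = gam\<close>: the vector \<open>d\<close> is a global minimizer.

  Since equality may hold in this bound, uniqueness needs another argument. If \<open>d + h\<close> is a second
  minimizer, then \<open>A h = 0\<close> and \<open>lam h\<^sub>T = 0\<close>, which forces the norm of \<open>h\<^sub>S\<close> to be at most \<open>1 - ERC\<close>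
  times the norm of \<open>h\<close> off \<open>T \<union> S\<close>. Equality of the penalties then gives \<open>h = 0\<close>, when \<open>gam > 0\<close>.

  The error bound comes from \<open>x - d = (x - c) + (c - d)\<close>, where \<open>Q (x - c) = lam (x - mu)\<^sub>T - A'w\<close>
  on \<open>T \<union> S\<close>.
\<close>

section \<open>Padded vectors and matrices\<close>

lemma subvec_nth [simp]: "subvec S b $ i = (if i \<in> S then b $ i else 0)"
  by (simp add: subvec_def)

lemma subvec_add: "subvec S (a + b) = subvec S a + subvec S b"
  by (simp add: vec_eq_iff)

lemma subvec_diff: "subvec S (a - b) = subvec S a - subvec S b"
  by (simp add: vec_eq_iff)

lemma subvec_scaleR: "subvec S (c *\<^sub>R a) = c *\<^sub>R subvec S a"
  by (simp add: vec_eq_iff)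

lemma subvec_zero [simp]: "subvec S 0 = 0"
  by (simp add: vec_eq_iff)

lemma subvec_subvec: "subvec S (subvec R b) = subvec (S \<inter> R) b"
  by (simp add: vec_eq_iff)

lemma subvec_idem [simp]: "subvec S (subvec S b) = subvec S b"
  by (simp add: subvec_subvec)

lemma subvec_inner: "subvec S a \<bullet> b = a \<bullet> subvec S b"
  unfolding inner_vec_def by (rule sum.cong) auto

lemma vsupp_subset_iff: "vsupp b \<subseteq> S \<longleftrightarrow> subvec S b = b"
  by (auto simp: vsupp_def vec_eq_iff)

lemma subvec_mono_eq: "subvec S b = b \<Longrightarrow> S \<subseteq> R \<Longrightarrow> subvec R b = b"
  by (metis Int_absorb1 subvec_subvec)

lemma subvec_disjoint: "subvec S b = b \<Longrightarrow> R \<inter> S = {} \<Longrightarrow> subvec R b = 0"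
  by (metis disjoint_iff subvec_nth vec_eq_iff zero_index)

lemma id_mat_mult_vec [simp]: "id_mat S *v b = subvec S b"
proof -
  have "(\<Sum>j\<in>UNIV. (if i = j \<and> i \<in> S then 1 else 0) * b $ j) = subvec S b $ i" for i
    by (cases "i \<in> S") (simp_all add: if_distrib[where f="\<lambda>u. u * _"] cong: if_cong)
  then show ?thesis
    by (simp add: vec_eq_iff matrix_vector_mult_def id_mat_def)
qed

lemma subcols_mult_vec [simp]: "subcols A S *v b = A *v subvec S b"
proof -
  have "(\<Sum>j\<in>UNIV. (if j \<in> S then A $ i $ j else 0) * b $ j)
      = (\<Sum>j\<in>UNIV. A $ i $ j * (if j \<in> S then b $ j else 0))" for i
    by (rule sum.cong) auto
  then show ?thesis
    by (simp add: vec_eq_iff matrix_vector_mult_def subcols_def)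
qed

lemma vec_mult_subcols [simp]: "z v* subcols A S = subvec S (z v* A)"
  by (simp add: vec_eq_iff vector_matrix_mult_def subcols_def)

lemma continuous_on_subvec: "continuous_on X (subvec S)"
  by (subst id_mat_mult_vec[symmetric, abs_def]) (rule matrix_vector_mult_linear_continuous_on)

lemma norm_mult_vec_le_spec_norm: "norm (M *v b) \<le> spec_norm M * norm b"
  unfolding spec_norm_def by (rule onorm) simp

lemma spec_norm_nonneg: "0 \<le> spec_norm M"
  unfolding spec_norm_def by (rule onorm_pos_le) simp

section \<open>The l1 norm\<close>

lemma norm1_triangle: "norm1 (a + b) \<le> norm1 a + norm1 b"
  unfolding norm1_def sum.distrib[symmetric] by (rule sum_mono) simp

lemma norm1_scaleR: "norm1 (c *\<^sub>R a) = \<bar>c\<bar> * norm1 a"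
  by (simp add: norm1_def abs_mult sum_distrib_left)

lemma norm1_nonneg: "0 \<le> norm1 a"
  by (simp add: norm1_def sum_nonneg)

lemma norm1_uminus [simp]: "norm1 (- a) = norm1 a"
  by (simp add: norm1_def)

lemma norm1_sum: "finite I \<Longrightarrow> norm1 (\<Sum>i\<in>I. f i) \<le> (\<Sum>i\<in>I. norm1 (f i))"
proof (induction I rule: finite_induct)
  case empty
  then show ?case by (simp add: norm1_def)
next
  case (insert i I)
  then show ?case
    using norm1_triangle[of "f i" "\<Sum>i\<in>I. f i"] by simp
qed

lemma norm1_eq_0_iff: "norm1 a = 0 \<longleftrightarrow> a = 0"
  by (simp add: norm1_def sum_nonneg_eq_0_iff vec_eq_iff)

lemma norm1_subvec_Un:
  "S \<inter> R = {} \<Longrightarrow> norm1 (subvec (S \<union> R) a) = norm1 (subvec S a) + norm1 (subvec R a)"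
  unfolding norm1_def sum.distrib[symmetric] by (rule sum.cong) auto

text \<open>Hoelder's inequality for the exponents 1 and infinity. It turns entrywise bounds on a
  gradient into bounds by the penalty.\<close>

lemma inner_le_norm1:
  assumes "\<And>i. \<bar>v $ i\<bar> \<le> k"
  shows "\<bar>a \<bullet> v\<bar> \<le> k * norm1 a"
proof -
  have "\<bar>a \<bullet> v\<bar> \<le> (\<Sum>i\<in>UNIV. \<bar>a $ i * v $ i\<bar>)"
    unfolding inner_vec_def by simp
  also have "\<dots> \<le> (\<Sum>i\<in>UNIV. k * \<bar>a $ i\<bar>)"
    by (rule sum_mono) (metis abs_ge_zero abs_mult assms mult.commute mult_right_mono)
  finally show ?thesis
    by (simp add: norm1_def sum_distrib_left)
qed

text \<open>Only the entries in \<open>S\<close> contribute, each with a square of at most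
  \<open>k\<^sup>2\<close>. This is the source of the factor \<open>sqrt (card S)\<close> in the
  error bound.\<close>

lemma norm_le_sqrt_card:
  fixes v :: "real^'m"
  assumes "subvec S v = v" "\<And>i. i \<in> S \<Longrightarrow> \<bar>v $ i\<bar> \<le> k" "0 \<le> k"
  shows "norm v \<le> k * sqrt (real (card S))"
proof -
  have "(norm v)\<^sup>2 = (\<Sum>i\<in>UNIV. (v $ i)\<^sup>2)"
    unfolding power2_norm_eq_inner inner_vec_def by (simp add: power2_eq_square)
  also have "\<dots> = (\<Sum>i\<in>S. (v $ i)\<^sup>2)"
    using assms(1) by (intro sum.mono_neutral_right) (auto simp: vec_eq_iff, metis)
  also have "\<dots> \<le> (\<Sum>i\<in>S. k\<^sup>2)"
    using assms(2,3) by (intro sum_mono) (metis abs_le_square_iff abs_of_nonneg)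
  also have "\<dots> = (k * sqrt (real (card S)))\<^sup>2"
    by (simp add: power_mult_distrib)
  finally show ?thesis
    by (rule power2_le_imp_le) (simp add: assms(3))
qed

section \<open>Inverses on an index set\<close>

text \<open>The usual argument \<open>B = B (M C) = (B M) C = C\<close>. The vanishing of
  \<open>B\<close> and \<open>C\<close> outside \<open>S\<close> makes \<open>id_mat S\<close> a
  right unit for \<open>B\<close> and a left unit for \<open>C\<close>.\<close>

lemma is_inverse_on_unique:
  assumes "is_inverse_on S M B" "is_inverse_on S M C"
  shows "B = C"
proof -
  have "B *v subvec S b = B *v b" for b
    using assms(1) unfolding matrix_vector_mult_def vec_eq_iff is_inverse_on_def
    by (auto intro!: sum.cong) blast
  then have B: "B ** id_mat S = B"
    by (simp add: matrix_eq flip: matrix_vector_mul_assoc)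
  have "C $ i $ j = 0" if "i \<notin> S" for i j
    using assms(2) that unfolding is_inverse_on_def by blast
  then have "subvec S (C *v b) = C *v b" for b
    by (simp add: vec_eq_iff matrix_vector_mult_def)
  then have C: "id_mat S ** C = C"
    by (simp add: matrix_eq flip: matrix_vector_mul_assoc)
  have "B = B ** (M ** C)"
    using B assms(2) by (simp add: is_inverse_on_def)
  also have "\<dots> = C"
    using C assms(1) by (simp add: is_inverse_on_def matrix_mul_assoc)
  finally show ?thesis .
qed

lemma inverse_on_works:
  assumes "invertible_on S M"
  shows "is_inverse_on S M (inverse_on S M)"
  using assms unfolding invertible_on_def inverse_on_def
  by (metis is_inverse_on_unique theI)

lemma inverse_on_mult:
  assumes "invertible_on S M"
  shows "M *v (inverse_on S M *v b) = subvec S b" "inverse_on S M *v (M *v b) = subvec S b"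
  using inverse_on_works[OF assms] unfolding is_inverse_on_def
  by (metis id_mat_mult_vec matrix_vector_mul_assoc)+

lemma subvec_inverse_on:
  assumes "invertible_on S M"
  shows "subvec S (inverse_on S M *v b) = inverse_on S M *v b"
proof -
  have "inverse_on S M $ i $ j = 0" if "i \<notin> S" for i j
    using inverse_on_works[OF assms] that unfolding is_inverse_on_def by blast
  then show ?thesis
    by (simp add: vec_eq_iff matrix_vector_mult_def)
qed

text \<open>A self-adjoint matrix has a self-adjoint inverse: \<open>subvec S b\<close> is rewritten
  as \<open>M\<close> applied to the inverse image of \<open>b\<close>, and \<open>M\<close> is
  moved to the other side.\<close>

lemma inverse_on_inner_commute:
  assumes "invertible_on S M" and sym: "\<And>a b. (M *v a) \<bullet> b = a \<bullet> (M *v b)"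
  shows "(inverse_on S M *v a) \<bullet> b = a \<bullet> (inverse_on S M *v b)"
proof -
  let ?B = "inverse_on S M"
  have "(?B *v a) \<bullet> b = (?B *v a) \<bullet> subvec S b"
    by (metis assms(1) subvec_inner subvec_inverse_on)
  also have "\<dots> = (?B *v a) \<bullet> (M *v (?B *v b))"
    by (simp add: inverse_on_mult[OF assms(1)])
  also have "\<dots> = subvec S a \<bullet> (?B *v b)"
    by (subst sym[symmetric]) (simp only: inverse_on_mult[OF assms(1)])
  also have "\<dots> = a \<bullet> (?B *v b)"
    by (metis assms(1) subvec_inner subvec_inverse_on)
  finally show ?thesis .
qed

(* Complementing M by the identity on -S turns it into an invertible matrix of full size. *)
lemma invertible_onI:
  fixes M :: "real^'m^'m"
  assumes "\<And>b. subvec S (M *v b) = M *v b" "\<And>b. M *v subvec S b = M *v b"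
    and ker: "\<And>b. subvec S b = b \<Longrightarrow> M *v b = 0 \<Longrightarrow> b = 0"
  shows "invertible_on S M"
proof -
  define N where "N = M + id_mat (- S)"
  have N: "N *v b = M *v b + subvec (- S) b" for b
    by (simp add: N_def matrix_vector_mult_add_rdistrib)
  have split: "b = subvec S b + subvec (- S) b" for b :: "real^'m"
    by (simp add: vec_eq_iff)
  have SN: "subvec S (N *v b) = M *v b" for b
    by (simp add: N subvec_add assms(1) subvec_subvec) (simp add: vec_eq_iff)
  have NS: "N *v subvec S b = M *v b" for b
    by (simp add: N assms(2) subvec_subvec) (simp add: vec_eq_iff)
  have "b = 0" if "N *v b = 0" for b
  proof -
    have M0: "M *v b = 0" using SN[of b] that by simp
    then have "subvec (- S) b = 0" using N[of b] that by simp
    moreover have "subvec S b = 0"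
      by (rule ker) (simp_all add: assms(2) M0)
    ultimately show ?thesis using split[of b] by simp
  qed
  then obtain B where BN: "B ** N = mat 1"
    using matrix_left_invertible_ker[of N] by blast
  then have NB: "N ** B = mat 1"
    using matrix_left_right_inverse by blast
  have BNv: "B *v (N *v b) = b" and NBv: "N *v (B *v b) = b" for b
    by (simp_all add: matrix_vector_mul_assoc BN NB)
  \<comment> \<open>\<open>N\<close> respects the splitting into \<open>S\<close> and its
    complement, so its inverse does too. Hence the compression \<open>C\<close> of \<open>B\<close>
    to \<open>S\<close> is the inverse sought.\<close>
  have BS: "B *v subvec S b = subvec S (B *v b)" for b
    by (metis BNv NBv NS SN)
  define C where "C = id_mat S ** B"
  have C: "C *v b = subvec S (B *v b)" for b
    by (simp add: C_def flip: matrix_vector_mul_assoc)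
  have "M ** C = id_mat S"
    by (simp add: matrix_eq C NBv flip: matrix_vector_mul_assoc)
       (metis NBv SN assms(2))
  moreover have "C ** M = id_mat S"
    by (simp add: matrix_eq C flip: matrix_vector_mul_assoc)
       (metis BNv BS SN subvec_idem)
  moreover have "i \<in> S \<and> j \<in> S" if "C $ i $ j \<noteq> 0" for i j
  proof -
    have Cij: "C $ i $ j = (C *v axis j 1) $ i"
      by (simp add: matrix_vector_mul_component inner_axis)
    have "i \<in> S" using that unfolding Cij C by (auto split: if_splits)
    moreover have "j \<in> S"
    proof (rule ccontr)
      assume "j \<notin> S"
      then have "subvec S (axis j 1) = (0 :: real^'m)"
        by (auto simp: vec_eq_iff axis_def)
      then have "C *v axis j 1 = 0" by (simp add: C flip: BS)
      then show False using that Cij by simp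
    qed
    ultimately show ?thesis by simp
  qed
  ultimately show ?thesis
    unfolding invertible_on_def is_inverse_on_def by blast
qed

section \<open>The block structure of the regularized Gram matrix\<close>

locale regularized_gram =
  fixes A :: "real^'m^'n" and T S :: "'m set" and lam :: real
  assumes disj: "T \<inter> S = {}" and lam_nonneg: "0 \<le> lam"
    and Q_invertible: "invertible_on (T \<union> S) (Q_mat A T lam S)"
begin

abbreviation "Q \<equiv> Q_mat A T lam S"
abbreviation "Qi \<equiv> inverse_on (T \<union> S) Q"
abbreviation "G \<equiv> G_mat A T lam"
abbreviation "Gi \<equiv> inverse_on T G"
abbreviation "M \<equiv> M_mat A T lam"
abbreviation "P \<equiv> P_mat A T lam S"
abbreviation "R \<equiv> transpose (subcols A S) ** M ** subcols A S"

text \<open>Twice the second order term of the objective. For \<open>h\<close> supported on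
  \<open>T \<union> S\<close> it is the quadratic form of \<open>Q\<close>, but it is also applied
  to arbitrary \<open>h\<close>.\<close>

definition q :: "real^'m \<Rightarrow> real" where
  "q h = (norm (A *v h))\<^sup>2 + lam * (norm (subvec T h))\<^sup>2"

lemma q_nonneg: "0 \<le> q h"
  by (simp add: q_def lam_nonneg)

lemma q_scaleR: "q (t *\<^sub>R h) = t\<^sup>2 * q h"
  by (simp add: q_def matrix_vector_mult_scaleR subvec_scaleR power_mult_distrib algebra_simps)

lemma q_eq_0D:
  assumes "q h = 0"
  shows "A *v h = 0" "lam *\<^sub>R subvec T h = 0"
proof -
  have "0 \<le> (norm (A *v h))\<^sup>2" "0 \<le> lam * (norm (subvec T h))\<^sup>2"
    using lam_nonneg by auto
  then have "(norm (A *v h))\<^sup>2 = 0" "lam * (norm (subvec T h))\<^sup>2 = 0"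
    using assms unfolding q_def by linarith+
  then show "A *v h = 0" "lam *\<^sub>R subvec T h = 0" by auto
qed

lemma Q_vec: "Q *v b = subvec (T \<union> S) ((A *v subvec (T \<union> S) b) v* A) + lam *\<^sub>R subvec T b"
  by (simp add: Q_mat_def matrix_vector_mult_add_rdistrib scaleR_matrix_vector_assoc[symmetric]
      flip: matrix_vector_mul_assoc)

lemma G_vec: "G *v b = subvec T ((A *v subvec T b) v* A) + lam *\<^sub>R subvec T b"
  by (simp add: G_mat_def matrix_vector_mult_add_rdistrib scaleR_matrix_vector_assoc[symmetric]
      flip: matrix_vector_mul_assoc)

lemma M_vec: "M *v z = z - A *v subvec T (Gi *v subvec T (z v* A))"
  by (simp add: M_mat_def matrix_vector_mult_diff_rdistrib flip: matrix_vector_mul_assoc)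

lemma R_vec: "R *v b = subvec S ((M *v (A *v subvec S b)) v* A)"
  by (simp flip: matrix_vector_mul_assoc)

lemma Q_kernel:
  assumes "subvec (T \<union> S) h = h" "Q *v h = 0"
  shows "h = 0"
  using inverse_on_mult(2)[OF Q_invertible, of h] assms by simp

text \<open>Both summands of \<open>Q *v h\<close> vanish with \<open>q h\<close>, and
  \<open>Q\<close> has trivial kernel on these vectors.\<close>

lemma q_definite:
  assumes "subvec (T \<union> S) h = h" "q h = 0"
  shows "h = 0"
  by (rule Q_kernel) (simp_all add: assms Q_vec q_eq_0D[OF assms(2)])

text \<open>On vectors supported on \<open>T\<close> the quadratic form of \<open>G\<close> is
  \<open>q\<close>, so \<open>G\<close> inherits definiteness from \<open>Q\<close>.\<close>

lemma G_invertible: "invertible_on T G"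
proof (rule invertible_onI)
  fix b assume b: "subvec T b = b" "G *v b = 0"
  have "b \<bullet> (G *v b) = q b"
    using b(1) by (simp add: G_vec q_def inner_add_right power2_norm_eq_inner
        flip: subvec_inner) (metis dot_lmul_matrix inner_commute)
  then have "q b = 0" using b(2) by simp
  then show "b = 0"
    by (rule q_definite[rotated]) (rule subvec_mono_eq[OF b(1)], simp)
qed (simp_all add: G_vec subvec_add subvec_scaleR)

lemma gram_inner_commute:
  "subvec V ((A *v subvec V a) v* A) \<bullet> b = a \<bullet> subvec V ((A *v subvec V b) v* A)"
proof -
  have *: "subvec V ((A *v subvec V a) v* A) \<bullet> b = (A *v subvec V a) \<bullet> (A *v subvec V b)" for a b
    by (simp add: subvec_inner dot_lmul_matrix)
  show ?thesis
    unfolding *[of a] inner_commute[of a] *[of b] by (rule inner_commute)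
qed

lemma G_symmetric: "(G *v a) \<bullet> b = a \<bullet> (G *v b)"
  by (simp add: G_vec inner_add_left inner_add_right gram_inner_commute subvec_inner[of T a b])

lemma M_symmetric: "(M *v z) \<bullet> z' = z \<bullet> (M *v z')"
proof -
  have "(A *v subvec T (Gi *v subvec T (z v* A))) \<bullet> z'
      = (Gi *v subvec T (z v* A)) \<bullet> subvec T (z' v* A)" for z z'
    by (metis dot_lmul_matrix inner_commute subvec_inner)
  moreover have "(Gi *v a) \<bullet> b = a \<bullet> (Gi *v b)" for a b
    by (rule inverse_on_inner_commute[OF G_invertible G_symmetric])
  ultimately show ?thesis
    by (simp add: M_vec inner_diff_left inner_diff_right) (metis inner_commute)
qed

(* Block elimination: k completes h on S to the vector on T \<union> S whose image under Q vanishes on T. *)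
definition k :: "real^'m \<Rightarrow> real^'m" where
  "k h = h - Gi *v subvec T ((A *v h) v* A)"

lemma Gi_range: "subvec T (Gi *v b) = Gi *v b"
  by (rule subvec_inverse_on[OF G_invertible])

lemma A_k: "A *v k h = M *v (A *v h)"
  by (simp add: k_def M_vec Gi_range matrix_vector_mult_diff_distrib)

text \<open>The equation for \<open>G *v g\<close> leaves \<open>lam *\<^sub>R g\<close> as the
  \<open>T\<close> part of \<open>A'A (k h)\<close>, and the regularization term cancels it because
  \<open>k h\<close> equals \<open>-g\<close> on \<open>T\<close>. What survives on \<open>S\<close>
  is \<open>R *v h\<close>: \<open>R\<close> is the Schur complement of the block \<open>G\<close>
  in \<open>Q\<close>.\<close>

lemma Q_k:
  assumes h: "subvec S h = h"
  shows "subvec (T \<union> S) (k h) = k h" "Q *v k h = R *v h"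
proof -
  have Th: "subvec T h = 0"
    by (rule subvec_disjoint[OF h disj])
  show sup: "subvec (T \<union> S) (k h) = k h"
    using subvec_mono_eq[OF h] subvec_mono_eq[OF Gi_range]
    by (simp add: k_def subvec_diff)
  define g where "g = Gi *v subvec T ((A *v h) v* A)"
  have Tk: "subvec T (k h) = - g"
    by (simp add: k_def subvec_diff Th Gi_range g_def)
  have "G *v g = subvec T ((A *v h) v* A)"
    by (simp add: g_def inverse_on_mult[OF G_invertible])
  then have g: "subvec T ((A *v g) v* A) + lam *\<^sub>R g = subvec T ((A *v h) v* A)"
    by (simp add: G_vec g_def Gi_range)
  have split: "subvec (T \<union> S) b = subvec T b + subvec S b" for b :: "real^'m"
    using disj by (auto simp: vec_eq_iff)
  have kg: "k h = h - g" by (simp add: k_def g_def)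
  have "subvec T ((A *v k h) v* A) = lam *\<^sub>R g"
    using g by (simp add: kg matrix_vector_mult_diff_distrib vector_matrix_mult_diff_distrib
        subvec_diff algebra_simps)
  then have "Q *v k h = subvec S ((A *v k h) v* A)"
    unfolding Q_vec sup split[of "(A *v k h) v* A"] Tk by simp
  then show "Q *v k h = R *v h"
    by (simp add: R_vec h A_k)
qed

text \<open>A kernel vector \<open>h\<close> of the Schur complement lifts to the kernel vector
  \<open>k h\<close> of \<open>Q\<close>. Then \<open>k h = 0\<close> puts the support of
  \<open>h\<close> inside both \<open>T\<close> and \<open>S\<close>, which are disjoint.\<close>

lemma R_invertible: "invertible_on S R"
proof (rule invertible_onI)
  fix h assume h: "subvec S h = h" "R *v h = 0"
  have "k h = 0"
    using Q_kernel Q_k[OF h(1)] h(2) by simp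
  then have "h = subvec T h"
    by (simp add: k_def) (metis Gi_range)
  then show "h = 0"
    using subvec_disjoint[OF h(1) disj] by simp
qed (simp_all add: R_vec)

lemma R_symmetric: "(R *v a) \<bullet> b = a \<bullet> (R *v b)"
proof -
  have *: "(R *v a) \<bullet> b = (M *v (A *v subvec S a)) \<bullet> (A *v subvec S b)" for a b
    unfolding R_vec by (simp add: subvec_inner dot_lmul_matrix)
  show ?thesis
    unfolding *[of a] inner_commute[of a] *[of b] M_symmetric[of "A *v subvec S a"]
    by (rule inner_commute)
qed

lemma P_symmetric: "(P *v a) \<bullet> b = a \<bullet> (P *v b)"
  unfolding P_mat_def by (rule inverse_on_inner_commute[OF R_invertible R_symmetric])

lemma P_range: "subvec S (P *v b) = P *v b"
  unfolding P_mat_def by (rule subvec_inverse_on[OF R_invertible])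

text \<open>The block formula for the columns of the inverse of \<open>Q\<close> that belong to
  \<open>S\<close>: the candidate has the same image under \<open>Q\<close>, whose kernel is
  trivial.\<close>

lemma Q_inverse_on_S:
  assumes "subvec (T \<union> S) h = h" "subvec S (Q *v h) = Q *v h"
  shows "h = k (P *v (Q *v h))"
proof -
  define p where "p = P *v (Q *v h)"
  have p: "subvec S p = p" by (simp add: p_def P_range)
  have "Q *v k p = Q *v h"
    unfolding Q_k(2)[OF p] by (simp only: p_def P_mat_def inverse_on_mult[OF R_invertible] assms(2))
  then have "Q *v (h - k p) = 0"
    by (simp only: matrix_vector_mult_diff_distrib diff_self)
  then have "h - k p = 0"
    by (rule Q_kernel[rotated]) (simp only: subvec_diff assms(1) Q_k(1)[OF p])
  then show ?thesis by (simp add: p_def)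
qed

section \<open>The matrix behind ERC and its l1 estimates\<close>

abbreviation "W \<equiv> P ** transpose (subcols A S) ** M"

lemma W_vec: "W *v z = P *v subvec S ((M *v z) v* A)"
  by (simp flip: matrix_vector_mul_assoc)

text \<open>\<open>W\<close> is a left inverse of \<open>A\<close> on vectors supported on
  \<open>S\<close>, since there \<open>W A\<close> is \<open>P\<close> composed with
  \<open>R\<close>.\<close>

lemma W_A:
  assumes "subvec S h = h"
  shows "W *v (A *v h) = h"
proof -
  have "W *v (A *v h) = P *v (R *v h)"
    by (simp add: W_vec R_vec assms)
  then show ?thesis
    by (simp add: P_mat_def inverse_on_mult[OF R_invertible] assms)
qed

lemma norm1_W_column_le:
  assumes "i \<notin> T \<union> S"
  shows "norm1 (W *v column i A) \<le> 1 - ERC A T lam S"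
proof -
  let ?F = "(\<lambda>\<omega>. norm1 (W *v column \<omega> A)) ` (- (T \<union> S))"
  have "norm1 (W *v column i A) \<in> ?F"
    using assms by (intro imageI) simp
  \<comment> \<open>A column outside \<open>T \<union> S\<close> exists, so the default value 0 of
    \<open>max0\<close> does not arise.\<close>
  moreover from this have "max0 ?F = Max ?F"
    unfolding max0_def by (metis empty_iff)
  ultimately show ?thesis
    using Max_ge[of ?F "norm1 (W *v column i A)"] by (simp add: ERC_def)
qed

text \<open>\<open>A *v h\<close> is a combination of columns outside \<open>T \<union> S\<close>,
  so the column bound passes through the triangle inequality.\<close>

lemma norm1_W_le:
  assumes h: "subvec (- (T \<union> S)) h = h"
  shows "norm1 (W *v (A *v h)) \<le> (1 - ERC A T lam S) * norm1 h"
proof -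
  have "W *v (A *v h) = (\<Sum>i\<in>UNIV. (h $ i) *\<^sub>R (W *v column i A))"
    unfolding matrix_mult_sum[of A] by (simp add: scalar_mult_eq_scaleR
        linear_sum[OF matrix_vector_mul_linear] matrix_vector_mult_scaleR)
  then have "norm1 (W *v (A *v h)) \<le> (\<Sum>i\<in>UNIV. \<bar>h $ i\<bar> * norm1 (W *v column i A))"
    using norm1_sum[of UNIV "\<lambda>i. (h $ i) *\<^sub>R (W *v column i A)"] by (simp add: norm1_scaleR)
  also have "\<dots> \<le> (\<Sum>i\<in>UNIV. \<bar>h $ i\<bar> * (1 - ERC A T lam S))"
  proof (rule sum_mono)
    fix i
    show "\<bar>h $ i\<bar> * norm1 (W *v column i A) \<le> \<bar>h $ i\<bar> * (1 - ERC A T lam S)"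
    proof (cases "i \<in> T \<union> S")
      case True
      then have "h $ i = 0"
        using h by (metis ComplD subvec_nth)
      then show ?thesis by simp
    next
      case False
      then show ?thesis by (intro mult_left_mono norm1_W_column_le abs_ge_zero)
    qed
  qed
  finally show ?thesis
    by (simp add: norm1_def sum_distrib_left mult.commute)
qed

(* Positivity of ERC acts here as a null space property. *)
lemma norm1_kernel_le:
  assumes "A *v h = 0" "lam *\<^sub>R subvec T h = 0"
  shows "norm1 (subvec S h) \<le> (1 - ERC A T lam S) * norm1 (subvec (- (T \<union> S)) h)"
proof -
  let ?r = "subvec (- (T \<union> S)) h"
  have split: "h = subvec T h + subvec S h + ?r"
    using disj by (auto simp: vec_eq_iff)
  \<comment> \<open>The regularization term vanishes, so \<open>subvec T h\<close> solves its own
    normal equations without it and \<open>M\<close> annihilates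
    \<open>A *v subvec T h\<close>.\<close>
  have "G *v h = subvec T ((A *v subvec T h) v* A)"
    using assms(2) by (simp add: G_vec)
  then have "Gi *v subvec T ((A *v subvec T h) v* A) = subvec T h"
    using inverse_on_mult(2)[OF G_invertible, of h] by simp
  then have "M *v (A *v subvec T h) = 0"
    by (simp add: M_vec)
  then have "W *v (A *v subvec T h) = 0"
    by (simp add: W_vec)
  moreover have "W *v (A *v (subvec T h + subvec S h + ?r)) = 0"
    using assms(1) split by simp
  ultimately have "subvec S h = - (W *v (A *v ?r))"
    using W_A[of "subvec S h"]
    by (simp add: matrix_vector_right_distrib eq_neg_iff_add_eq_0)
  then show ?thesis
    using norm1_W_le[of ?r] by simp
qed

text \<open>The vector splits into \<open>P *v v\<close>, supported on \<open>S\<close>, and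
  \<open>- ?F *v v\<close>, supported on \<open>T\<close>. These are orthogonal, so the squared
  spectral bounds add up to the square of \<open>f1\<close>.\<close>

lemma norm_k_P_le: "norm (k (P *v v)) \<le> f1 A T lam S * norm v"
proof -
  let ?F = "Gi ** transpose (subcols A T) ** subcols A S ** P"
  have F: "?F *v v = Gi *v subvec T ((A *v (P *v v)) v* A)"
    by (simp add: P_range flip: matrix_vector_mul_assoc)
  have "(P *v v) \<bullet> (?F *v v) = subvec S (P *v v) \<bullet> subvec T (?F *v v)"
    by (simp add: P_range F Gi_range)
  also have "\<dots> = 0"
    using disj by (auto simp: inner_vec_def intro!: sum.neutral)
  finally have "(norm (k (P *v v)))\<^sup>2 = (norm (P *v v))\<^sup>2 + (norm (?F *v v))\<^sup>2"
    unfolding k_def F[symmetric] power2_norm_eq_inner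
    by (simp add: inner_diff_left inner_diff_right inner_commute)
  also have "\<dots> \<le> (spec_norm P * norm v)\<^sup>2 + (spec_norm ?F * norm v)\<^sup>2"
    by (intro add_mono power_mono norm_mult_vec_le_spec_norm norm_ge_zero)
  also have "\<dots> = (f1 A T lam S * norm v)\<^sup>2"
    by (simp add: f1_def power_mult_distrib algebra_simps)
  finally show ?thesis
    by (rule power2_le_imp_le) (simp add: f1_def)
qed

end

section \<open>The penalized least squares problem\<close>

text \<open>Divide by \<open>t\<close> and let \<open>t\<close> tend to 0. This extracts the first
  order condition from minimality along a segment.\<close>

lemma nonneg_of_quadratic:
  fixes X K :: real
  assumes "\<And>t. 0 < t \<Longrightarrow> t \<le> 1 \<Longrightarrow> 0 \<le> t * X + t\<^sup>2 * K"
  shows "0 \<le> X"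
proof -
  have "((\<lambda>t. X + t * K) \<longlongrightarrow> X + 0 * K) (at_right 0)"
    by (intro tendsto_intros)
  moreover have "\<forall>\<^sub>F t in at_right 0. 0 \<le> X + t * K"
    unfolding eventually_at_right_field
  proof (intro exI[of _ 1] conjI allI impI)
    fix t :: real assume t: "0 < t" "t < 1"
    have "0 \<le> t * (X + t * K)"
      using assms[of t] t by (simp add: power2_eq_square algebra_simps)
    then show "0 \<le> X + t * K"
      using t by (simp add: zero_le_mult_iff)
  qed simp
  ultimately show ?thesis
    using tendsto_lowerbound by fastforce
qed

locale regularized_ls = regularized_gram A T S lam
  for A :: "real^'m^'n" and T S :: "'m set" and lam :: real +
  fixes y :: "real^'n" and mu :: "real^'m"
begin

abbreviation "L \<equiv> L_fun A y T lam mu"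

text \<open>This is the negative gradient of \<open>L1_fun\<close>.\<close>

definition grad :: "real^'m \<Rightarrow> real^'m" where
  "grad b = (y - A *v b) v* A - lam *\<^sub>R subvec T (b - mu)"

text \<open>The smooth part is quadratic, so its expansion is exact; the change of the penalty is
  kept as it stands.\<close>

lemma L_expand:
  "L gam (b + h) = L gam b + gam * (norm1 (subvec (- T) (b + h)) - norm1 (subvec (- T) b))
     - grad b \<bullet> h + q h / 2"
proof -
  have 1: "(norm (y - A *v (b + h)))\<^sup>2
      = (norm (y - A *v b))\<^sup>2 - 2 * (((y - A *v b) v* A) \<bullet> h) + (norm (A *v h))\<^sup>2"
    unfolding dot_lmul_matrix power2_norm_eq_inner
    by (simp add: matrix_vector_right_distrib inner_diff_left inner_diff_right inner_add_left
        inner_add_right inner_commute)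
  have 2: "(norm (subvec T (b + h) - subvec T mu))\<^sup>2
      = (norm (subvec T b - subvec T mu))\<^sup>2 + 2 * (subvec T (b - mu) \<bullet> h) + (norm (subvec T h))\<^sup>2"
  proof -
    have "subvec T (b - mu) \<bullet> h = subvec T (b - mu) \<bullet> subvec T h"
      by (metis subvec_idem subvec_inner)
    then show ?thesis
      unfolding power2_norm_eq_inner
      by (simp add: subvec_add subvec_diff inner_diff_left inner_diff_right inner_add_left
          inner_add_right inner_commute)
  qed
  show ?thesis
    unfolding L_fun_def L1_fun_def 1 2 grad_def q_def
    by (simp add: inner_diff_left algebra_simps)
qed

section \<open>First order conditions\<close>

lemma first_order:
  assumes min: "is_arg_min (L gam) (\<lambda>b. vsupp b \<subseteq> T \<union> S) d" and gam: "0 \<le> gam"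
    and h: "subvec (T \<union> S) h = h"
  shows "grad d \<bullet> h \<le> gam * (norm1 (subvec (- T) (d + h)) - norm1 (subvec (- T) d))"
proof -
  let ?n = "\<lambda>b. norm1 (subvec (- T) b)"
  have d: "subvec (T \<union> S) d = d"
    using min by (simp add: is_arg_min_def vsupp_subset_iff)
  have "0 \<le> t * (gam * (?n (d + h) - ?n d) - grad d \<bullet> h) + t\<^sup>2 * (q h / 2)"
    if t: "0 < t" "t \<le> 1" for t
  proof -
    have "subvec (T \<union> S) (d + t *\<^sub>R h) = d + t *\<^sub>R h"
      by (simp add: subvec_add subvec_scaleR d h)
    then have "L gam d \<le> L gam (d + t *\<^sub>R h)"
      using min by (auto simp: is_arg_min_def vsupp_subset_iff not_less)
    \<comment> \<open>Convexity of the penalty: a step of length \<open>t\<close> costs at most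
      \<open>t\<close> times the full change.\<close>
    moreover have "?n (d + t *\<^sub>R h) \<le> (1 - t) * ?n d + t * ?n (d + h)"
    proof -
      have "d + t *\<^sub>R h = (1 - t) *\<^sub>R d + t *\<^sub>R (d + h)"
        by (simp add: algebra_simps)
      then show ?thesis
        using norm1_triangle[of "(1 - t) *\<^sub>R subvec (- T) d" "t *\<^sub>R subvec (- T) (d + h)"] t
        by (simp add: subvec_add subvec_scaleR norm1_scaleR)
    qed
    then have "gam * (?n (d + t *\<^sub>R h) - ?n d) \<le> gam * (t * (?n (d + h) - ?n d))"
      by (intro mult_left_mono gam) (simp add: algebra_simps)
    ultimately show ?thesis
      unfolding L_expand q_scaleR by (simp add: algebra_simps)
  qed
  from nonneg_of_quadratic[OF this] show ?thesis by simp
qed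

text \<open>The test directions change one entry by 1 or -1. The penalty ignores them on
  \<open>T\<close> and grows by at most \<open>gam\<close> on \<open>S\<close>, so the sign of the
  entry of \<open>d\<close> need not be known.\<close>

lemma grad_bound:
  assumes "is_arg_min (L gam) (\<lambda>b. vsupp b \<subseteq> T \<union> S) d" "0 \<le> gam"
  shows "i \<in> T \<Longrightarrow> grad d $ i = 0" "i \<in> S \<Longrightarrow> \<bar>grad d $ i\<bar> \<le> gam"
proof -
  have *: "s * grad d $ i \<le> gam * norm1 (subvec (- T) (axis i s))" if "i \<in> T \<union> S" for s
  proof -
    have "subvec (T \<union> S) (axis i s) = axis i s"
      using that by (auto simp: vec_eq_iff axis_def)
    from first_order[OF assms this]
    have "s * grad d $ i \<le> gam * (norm1 (subvec (- T) (d + axis i s)) - norm1 (subvec (- T) d))"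
      by (simp add: inner_axis mult.commute)
    also have "\<dots> \<le> gam * norm1 (subvec (- T) (axis i s))"
      using norm1_triangle[of "subvec (- T) d" "subvec (- T) (axis i s)"] assms(2)
      by (intro mult_left_mono) (simp_all add: subvec_add)
    finally show ?thesis .
  qed
  show "grad d $ i = 0" if "i \<in> T"
  proof -
    have "subvec (- T) (axis i s) = 0" for s :: real
      using that by (auto simp: vec_eq_iff axis_def)
    then show ?thesis using *[of 1] *[of "-1"] that by (simp add: norm1_def)
  qed
  show "\<bar>grad d $ i\<bar> \<le> gam" if "i \<in> S"
  proof -
    have "subvec (- T) (axis i s) = axis i s" for s :: real
      using that disj by (auto simp: vec_eq_iff axis_def)
    moreover have "norm1 (axis i s) = \<bar>s\<bar>" for s :: real
      by (simp add: norm1_def axis_def if_distrib cong: if_cong)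
    ultimately show ?thesis using *[of 1] *[of "-1"] that by (simp add: abs_le_iff)
  qed
qed

text \<open>\<open>grad\<close> is affine, and on \<open>T \<union> S\<close> its linear part is
  \<open>- Q\<close>.\<close>

lemma subvec_grad_diff:
  assumes "subvec (T \<union> S) b = b" "subvec (T \<union> S) b' = b'"
  shows "subvec (T \<union> S) (grad b - grad b') = Q *v (b' - b)"
proof -
  have "grad b - grad b' = (A *v (b' - b)) v* A + lam *\<^sub>R subvec T (b' - b)"
    by (simp add: grad_def subvec_diff algebra_simps vector_matrix_mult_diff_distrib
        matrix_vector_mult_diff_distrib)
  moreover have "subvec (T \<union> S) (b' - b) = b' - b"
    by (simp add: subvec_diff assms)
  ultimately show ?thesis
    by (simp add: Q_vec subvec_add subvec_scaleR subvec_subvec Int_absorb1)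
qed

section \<open>Existence and uniqueness of restricted minimizers\<close>

lemma L_strong_min:
  assumes "0 \<le> gam" "is_arg_min (L gam) (\<lambda>b. vsupp b \<subseteq> T \<union> S) d" "subvec (T \<union> S) b = b"
  shows "L gam d + q (b - d) / 2 \<le> L gam b"
proof -
  have "subvec (T \<union> S) (b - d) = b - d"
    using assms by (simp add: subvec_diff is_arg_min_def vsupp_subset_iff)
  \<comment> \<open>The first order inequality absorbs the penalty and the linear term of the
    expansion; the quadratic surplus remains.\<close>
  from first_order[OF assms(2,1) this] L_expand[of gam d "b - d"]
  show ?thesis by simp
qed

text \<open>A bounded objective bounds \<open>A *v b\<close> and
  \<open>lam *\<^sub>R subvec T b\<close>, hence \<open>Q *v b\<close>, hence \<open>b\<close>
  through \<open>Qi\<close>. As \<open>lam\<close> may be 0, \<open>subvec T b\<close> is controlled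
  only together with its weight.\<close>

lemma sublevel_bounded:
  assumes "0 \<le> gam"
  shows "\<exists>r. \<forall>b. subvec (T \<union> S) b = b \<longrightarrow> L gam b \<le> C \<longrightarrow> norm b \<le> r"
proof (intro exI allI impI)
  let ?B = "transpose (subcols A (T \<union> S))"
  fix b assume b: "subvec (T \<union> S) b = b" "L gam b \<le> C"
  define u where "u = norm (y - A *v b)"
  define n where "n = norm (subvec T b - subvec T mu)"
  have "0 \<le> gam * norm1 (subvec (- T) b)"
    by (simp add: assms norm1_nonneg)
  then have le: "u\<^sup>2 + lam * n\<^sup>2 \<le> 2 * C"
    using b(2) by (simp add: L_fun_def L1_fun_def u_def n_def)
  \<comment> \<open>A crude passage from squares to first powers. Multiplied by \<open>lam\<close>,
    it stays valid for \<open>lam = 0\<close>.\<close>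
  have t: "t \<le> 1 + t\<^sup>2" for t :: real
    using zero_le_power2[of "t - 1/2"] unfolding power2_diff by (simp add: field_simps)
  have "0 \<le> u\<^sup>2" "0 \<le> lam * n\<^sup>2"
    using lam_nonneg by auto
  moreover have "lam * n \<le> lam + lam * n\<^sup>2"
    using mult_left_mono[OF t[of n] lam_nonneg] by (simp add: distrib_left)
  ultimately have "u \<le> 1 + 2 * C" and n: "lam * n \<le> lam + 2 * C"
    using le t[of u] by linarith+
  then have Ab: "norm (A *v b) \<le> norm y + (1 + 2 * C)"
    using norm_triangle_ineq4[of y "y - A *v b"] by (simp add: u_def)
  have Tb: "norm (lam *\<^sub>R subvec T b) \<le> lam * norm (subvec T mu) + (lam + 2 * C)"
  proof -
    have "norm (subvec T b) \<le> norm (subvec T mu) + n"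
      using norm_triangle_ineq[of "subvec T mu" "subvec T b - subvec T mu"] by (simp add: n_def)
    from mult_left_mono[OF this lam_nonneg] n show ?thesis
      using lam_nonneg by (simp add: distrib_left)
  qed
  have "Q *v b = ?B *v (A *v b) + lam *\<^sub>R subvec T b"
    by (simp add: Q_vec b)
  then have "norm (Q *v b) \<le> norm (?B *v (A *v b)) + norm (lam *\<^sub>R subvec T b)"
    using norm_triangle_ineq by metis
  also have "\<dots> \<le> spec_norm ?B * (norm y + (1 + 2 * C)) + (lam * norm (subvec T mu) + (lam + 2 * C))"
    by (intro add_mono Tb order_trans[OF norm_mult_vec_le_spec_norm] mult_left_mono Ab spec_norm_nonneg)
  finally have Qb: "norm (Q *v b) \<le> \<dots>" .
  have "norm b = norm (Qi *v (Q *v b))"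
    by (simp add: inverse_on_mult[OF Q_invertible] b)
  also have "\<dots> \<le> spec_norm Qi * norm (Q *v b)"
    by (rule norm_mult_vec_le_spec_norm)
  also have "\<dots> \<le> spec_norm Qi *
      (spec_norm ?B * (norm y + (1 + 2 * C)) + (lam * norm (subvec T mu) + (lam + 2 * C)))"
    by (intro mult_left_mono Qb spec_norm_nonneg)
  finally show "norm b \<le> \<dots>" .
qed

text \<open>The objective is continuous on the compact set \<open>X\<close>, which contains every
  supported vector that does no worse than 0.\<close>

lemma ex_restricted_minimizer:
  assumes "0 \<le> gam"
  shows "\<exists>d. is_arg_min (L gam) (\<lambda>b. vsupp b \<subseteq> T \<union> S) d"
proof -
  obtain r where r: "\<And>b. subvec (T \<union> S) b = b \<Longrightarrow> L gam b \<le> L gam 0 \<Longrightarrow> norm b \<le> r"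
    using sublevel_bounded[OF assms] by blast
  define X where "X = {b. subvec (T \<union> S) b = b} \<inter> cball 0 r"
  have "0 \<in> X"
    using r[of 0] by (simp add: X_def)
  have "closed {b :: real^'m. subvec (T \<union> S) b = b}"
    by (intro closed_Collect_eq continuous_on_subvec continuous_on_id)
  then have "compact X"
    unfolding X_def by (rule closed_Int_compact) simp
  moreover have "continuous_on X (L gam)"
    unfolding L_fun_def[abs_def] L1_fun_def norm1_def
    by (intro continuous_intros continuous_on_subvec matrix_vector_mult_linear_continuous_on)
  ultimately obtain d where d: "d \<in> X" "\<And>b. b \<in> X \<Longrightarrow> L gam d \<le> L gam b"
    using continuous_attains_inf[of X "L gam"] \<open>0 \<in> X\<close> by blast
  have "L gam d \<le> L gam b" if b: "subvec (T \<union> S) b = b" for b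
  proof (cases "L gam b \<le> L gam 0")
    case True
    then have "b \<in> X"
      using b r[OF b] by (simp add: X_def)
    then show ?thesis by (rule d(2))
  next
    case False
    with d(2)[OF \<open>0 \<in> X\<close>] show ?thesis by simp
  qed
  with d(1) show ?thesis
    by (intro exI[of _ d]) (auto simp: is_arg_min_def vsupp_subset_iff X_def not_less)
qed

text \<open>Justifies the definite description: two minimizers have equal values, so the surplus
  \<open>q (b - d)\<close> is 0 and definiteness identifies them.\<close>

lemma is_arg_min_d_min:
  assumes "0 \<le> gam"
  shows "is_arg_min (L gam) (\<lambda>b. vsupp b \<subseteq> T \<union> S) (d_min A y T lam mu gam S)"
proof -
  obtain d where d: "is_arg_min (L gam) (\<lambda>b. vsupp b \<subseteq> T \<union> S) d"
    using ex_restricted_minimizer[OF assms] by blast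
  have "b = d" if b: "is_arg_min (L gam) (\<lambda>b. vsupp b \<subseteq> T \<union> S) b" for b
  proof -
    have sup: "subvec (T \<union> S) b = b" "subvec (T \<union> S) d = d"
      using b d by (simp_all add: is_arg_min_def vsupp_subset_iff)
    have "\<not> L gam d < L gam b"
      using b d by (simp add: is_arg_min_def)
    then have "q (b - d) = 0"
      using L_strong_min[OF assms d sup(1)] q_nonneg[of "b - d"] by simp
    then show ?thesis
      using q_definite[of "b - d"] sup by (simp add: subvec_diff)
  qed
  with d show ?thesis
    unfolding d_min_def by (rule theI[where P="is_arg_min _ _"])
qed

text \<open>Makes every fact on penalized minimizers available for \<open>c_min\<close> with
  \<open>gam = 0\<close>.\<close>

lemma c_min_eq_d_min: "c_min A y T lam mu S = d_min A y T lam mu 0 S"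
  by (simp add: c_min_def d_min_def L_fun_def[abs_def])

lemma
  assumes "0 \<le> gam"
  shows subvec_d_min: "subvec (T \<union> S) (d_min A y T lam mu gam S) = d_min A y T lam mu gam S"
    and c_min_diff_d_min: "c_min A y T lam mu S - d_min A y T lam mu gam S
      = k (P *v subvec S (grad (d_min A y T lam mu gam S)))"
    and subvec_grad_c_min: "subvec (T \<union> S) (grad (c_min A y T lam mu S)) = 0"
    and subvec_c_min: "subvec (T \<union> S) (c_min A y T lam mu S) = c_min A y T lam mu S"
proof -
  let ?d = "d_min A y T lam mu gam S" and ?c = "c_min A y T lam mu S"
  note d = is_arg_min_d_min[OF assms]
  note c = is_arg_min_d_min[of 0, folded c_min_eq_d_min, simplified]
  show sd: "subvec (T \<union> S) ?d = ?d" and sc: "subvec (T \<union> S) ?c = ?c"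
    using d c by (simp_all add: is_arg_min_def vsupp_subset_iff)
  show gc: "subvec (T \<union> S) (grad ?c) = 0"
    using grad_bound[OF c] by (auto simp: vec_eq_iff)
  have "subvec (T \<union> S) (grad ?d) = subvec S (grad ?d)"
    using grad_bound(1)[OF d assms] by (auto simp: vec_eq_iff)
  then have "Q *v (?c - ?d) = subvec S (grad ?d)"
    using subvec_grad_diff[OF sd sc] gc by (simp add: subvec_diff)
  then show "?c - ?d = k (P *v subvec S (grad ?d))"
    using Q_inverse_on_S[of "?c - ?d"] by (simp add: subvec_diff sd sc)
qed

section \<open>Global optimality and uniqueness\<close>

lemma grad_d_min_bound:
  assumes gam: "0 \<le> gam" and erc: "0 < ERC A T lam S" and ge: "gamma_star A y T lam mu S \<le> gam"
    and i: "i \<notin> T \<union> S"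
  shows "\<bar>grad (d_min A y T lam mu gam S) $ i\<bar> \<le> gam"
proof -
  let ?d = "d_min A y T lam mu gam S" and ?c = "c_min A y T lam mu S"
  note d = is_arg_min_d_min[OF gam]
  define v where "v = subvec S (grad ?d)"
  have v: "\<bar>v $ j\<bar> \<le> gam" for j
    using grad_bound(2)[OF d gam, of j] gam by (simp add: v_def)
  have col: "(z v* A) $ i = column i A \<bullet> z" for z
    by (simp add: vector_matrix_mult_def column_def inner_vec_def mult.commute)
  have "y - A *v ?d = (y - A *v ?c) + A *v (?c - ?d)"
    by (simp add: matrix_vector_mult_diff_distrib)
  then have "grad ?d $ i = ((y - A *v ?c) v* A) $ i + column i A \<bullet> (A *v (?c - ?d))"
    unfolding grad_def using i by (simp only: vector_matrix_left_distrib) (simp add: col)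
  also have "column i A \<bullet> (A *v (?c - ?d)) = column i A \<bullet> (M *v (A *v (P *v v)))"
    by (simp add: c_min_diff_d_min[OF gam] A_k v_def)
  \<comment> \<open>Symmetry of \<open>M\<close> and \<open>P\<close> moves both onto the column,
    which produces the vector measured in ERC.\<close>
  also have "\<dots> = (W *v column i A) \<bullet> v"
    unfolding W_vec by (metis M_symmetric P_range P_symmetric dot_lmul_matrix subvec_inner)
  finally have eq: "grad ?d $ i = ((y - A *v ?c) v* A) $ i + (W *v column i A) \<bullet> v" .
  have "\<bar>((y - A *v ?c) v* A) $ i\<bar> \<le> infnorm (transpose (subcols A (- (T \<union> S))) *v (y - A *v ?c))"
    using component_le_infnorm_cart[of "transpose (subcols A (- (T \<union> S))) *v (y - A *v ?c)" i] i
    by simp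
  also have "\<dots> \<le> gam * ERC A T lam S"
    using ge erc by (simp add: gamma_star_def pos_divide_le_eq)
  finally have "\<bar>((y - A *v ?c) v* A) $ i\<bar> \<le> gam * ERC A T lam S" .
  moreover have "\<bar>(W *v column i A) \<bullet> v\<bar> \<le> gam * (1 - ERC A T lam S)"
    using inner_le_norm1[OF v] mult_left_mono[OF norm1_W_column_le[OF i] gam] by (rule order_trans)
  ultimately show ?thesis
    unfolding eq by (simp add: algebra_simps)
qed

lemma norm1_compl_T:
  "norm1 (subvec (- T) b) = norm1 (subvec S b) + norm1 (subvec (- (T \<union> S)) b)"
proof -
  have "- T = S \<union> - (T \<union> S)" using disj by blast
  then show ?thesis
    using norm1_subvec_Un[of S "- (T \<union> S)" b] by auto
qed

text \<open>The displacement splits into \<open>h1\<close> on \<open>T \<union> S\<close>, covered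
  by the first order condition, and \<open>h2\<close> off it, where the entries of
  \<open>grad d\<close> are at most \<open>gam\<close> and the penalty pays for the linear
  term.\<close>

lemma L_strong_global_min:
  assumes gam: "0 \<le> gam" and erc: "0 < ERC A T lam S" and ge: "gamma_star A y T lam mu S \<le> gam"
  shows "L gam (d_min A y T lam mu gam S) + q (b - d_min A y T lam mu gam S) / 2 \<le> L gam b"
proof -
  define d where "d = d_min A y T lam mu gam S"
  note d = is_arg_min_d_min[OF gam, folded d_def]
  have sd: "subvec (T \<union> S) d = d"
    using subvec_d_min[OF gam] by (simp add: d_def)
  define h1 where "h1 = subvec (T \<union> S) (b - d)"
  define h2 where "h2 = subvec (- (T \<union> S)) b"
  have h2: "h2 = subvec (- (T \<union> S)) (b - d)"
    unfolding h2_def subvec_diff subvec_disjoint[OF sd Compl_disjoint2] by simp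
  have h: "b - d = h1 + h2"
    by (simp add: h1_def h2 vec_eq_iff)
  have "d + h1 = subvec (T \<union> S) b"
    by (simp add: h1_def subvec_diff sd)
  then have "subvec (- T) (d + h1) = subvec S b"
    using disj by (auto simp: vec_eq_iff)
  then have "grad d \<bullet> h1 \<le> gam * (norm1 (subvec S b) - norm1 (subvec (- T) d))"
    using first_order[OF d gam, of h1] by (simp add: h1_def)
  moreover have "grad d \<bullet> h2 \<le> gam * norm1 h2"
  proof -
    have "\<bar>subvec (- (T \<union> S)) (grad d) $ i\<bar> \<le> gam" for i
      using grad_d_min_bound[OF gam erc ge, of i] gam by (simp add: d_def)
    from inner_le_norm1[of "subvec (- (T \<union> S)) (grad d)", OF this, of h2]
    have "h2 \<bullet> subvec (- (T \<union> S)) (grad d) \<le> gam * norm1 h2"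
      by simp
    moreover have "h2 \<bullet> subvec (- (T \<union> S)) (grad d) = grad d \<bullet> h2"
      by (metis h2 inner_commute subvec_idem subvec_inner)
    ultimately show ?thesis by simp
  qed
  moreover have "norm1 (subvec (- T) b) = norm1 (subvec S b) + norm1 h2"
    by (simp add: norm1_compl_T h2_def)
  ultimately have "grad d \<bullet> (b - d) \<le> gam * (norm1 (subvec (- T) b) - norm1 (subvec (- T) d))"
    by (simp add: h inner_add_right algebra_simps)
  then show ?thesis
    using L_expand[of gam d "b - d"] by (simp add: d_def)
qed

lemma global_minimizer_unique:
  assumes gam: "0 < gam" and erc: "0 < ERC A T lam S" and ge: "gamma_star A y T lam mu S \<le> gam"
    and b: "is_arg_min (L gam) (\<lambda>_. True) b"
  shows "b = d_min A y T lam mu gam S"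
proof -
  define d where "d = d_min A y T lam mu gam S"
  have sd: "subvec (T \<union> S) d = d"
    using subvec_d_min gam by (simp add: d_def)
  define h where "h = b - d"
  define r where "r = subvec (- (T \<union> S)) h"
  have "L gam d + q h / 2 \<le> L gam b"
    using L_strong_global_min[OF _ erc ge, of b] gam by (simp add: d_def h_def)
  moreover have "L gam b \<le> L gam d"
    using b by (simp add: is_arg_min_def not_less)
  ultimately have q0: "q h = 0" and L_eq: "L gam b = L gam d"
    using q_nonneg[of h] by auto
  note ker = q_eq_0D[OF q0]
  have "grad d \<bullet> h = (y - A *v d) \<bullet> (A *v h) - (d - mu) \<bullet> (lam *\<^sub>R subvec T h)"
    by (simp add: grad_def inner_diff_left dot_lmul_matrix subvec_inner)
  then have "grad d \<bullet> h = 0"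
    using ker by simp
  \<comment> \<open>With the linear and the quadratic term gone, equal values force equal penalties;
    cancelling the factor uses \<open>gam > 0\<close>.\<close>
  then have "norm1 (subvec (- T) b) = norm1 (subvec (- T) d)"
    using L_expand[of gam d h] L_eq q0 gam by (simp add: h_def)
  moreover have "subvec (- (T \<union> S)) d = 0"
    by (rule subvec_disjoint[OF sd]) auto
  ultimately have "norm1 (subvec S b) + norm1 r = norm1 (subvec S d)"
    by (simp add: norm1_compl_T r_def h_def subvec_diff) (simp add: norm1_def)
  moreover have "norm1 (subvec S d) \<le> norm1 (subvec S b) + norm1 (subvec S h)"
    using norm1_triangle[of "subvec S b" "- subvec S h"] unfolding norm1_uminus
    by (simp add: h_def subvec_diff)
  moreover have "norm1 (subvec S h) \<le> (1 - ERC A T lam S) * norm1 r"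
    using norm1_kernel_le[OF ker] by (simp add: r_def)
  \<comment> \<open>The three facts chain to: the l1 norm of \<open>r\<close> is at most that of
    \<open>subvec S h\<close>, which is at most \<open>1 - ERC\<close> times that of
    \<open>r\<close>.\<close>
  ultimately have "ERC A T lam S * norm1 r \<le> 0"
    by (simp add: algebra_simps)
  then have "r = 0"
    using erc norm1_nonneg[of r] by (simp add: mult_le_0_iff flip: norm1_eq_0_iff)
  then have "subvec (T \<union> S) h = h"
    by (auto simp: r_def vec_eq_iff) metis
  then have "h = 0"
    using q_definite q0 by blast
  then show ?thesis by (simp add: h_def d_def)
qed

section \<open>The error bound\<close>

lemma norm_diff_d_min_le:
  assumes gam: "0 \<le> gam" and x: "subvec (T \<union> S) x = x"
  shows "norm (x - d_min A y T lam mu gam S) \<le> gam * sqrt (real (card S)) * f1 A T lam S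
    + lam * f2 A T lam S * norm (subvec T x - subvec T mu) + f3 A T lam S * norm (y - A *v x)"
proof -
  let ?d = "d_min A y T lam mu gam S" and ?c = "c_min A y T lam mu S"
  define v where "v = subvec S (grad ?d)"
  define e where "e = subvec T x - subvec T mu"
  have "norm v \<le> gam * sqrt (real (card S))"
    using grad_bound(2)[OF is_arg_min_d_min[OF gam] gam]
    by (intro norm_le_sqrt_card gam) (simp_all add: v_def)
  then have "f1 A T lam S * norm v \<le> f1 A T lam S * (gam * sqrt (real (card S)))"
    by (intro mult_left_mono) (simp_all add: f1_def)
  moreover have "norm (?c - ?d) \<le> f1 A T lam S * norm v"
    using norm_k_P_le by (simp add: c_min_diff_d_min[OF gam] v_def)
  ultimately have cd: "norm (?c - ?d) \<le> gam * sqrt (real (card S)) * f1 A T lam S"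
    by (simp add: mult_ac)
  \<comment> \<open>\<open>grad x\<close> is explicit and \<open>grad\<close> of \<open>?c\<close>
    vanishes on \<open>T \<union> S\<close>, so their difference yields
    \<open>Q *v (x - ?c)\<close>.\<close>
  have "subvec (T \<union> S) (grad x) = subvec (T \<union> S) ((y - A *v x) v* A) - lam *\<^sub>R e"
    by (simp add: grad_def e_def subvec_diff subvec_scaleR subvec_subvec Int_absorb1)
  then have "Q *v (x - ?c) = lam *\<^sub>R e - subvec (T \<union> S) ((y - A *v x) v* A)"
    using subvec_grad_diff[OF subvec_c_min[OF gam] x] subvec_grad_c_min[OF gam]
    by (simp add: subvec_diff)
  moreover have "x - ?c = Qi *v (Q *v (x - ?c))"
    using inverse_on_mult(2)[OF Q_invertible] x subvec_c_min[OF gam] by (simp add: subvec_diff)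
  ultimately have "x - ?c = lam *\<^sub>R (Qi *v e) - (Qi ** transpose (subcols A (T \<union> S))) *v (y - A *v x)"
    unfolding matrix_vector_mul_assoc[symmetric] transpose_matrix_vector vec_mult_subcols
    by (simp only: matrix_vector_mult_diff_distrib[of Qi "lam *\<^sub>R e"] matrix_vector_mult_scaleR)
  then have "norm (x - ?c) \<le> norm (lam *\<^sub>R (Qi *v e))
      + norm ((Qi ** transpose (subcols A (T \<union> S))) *v (y - A *v x))"
    using norm_triangle_ineq4 by metis
  also have "\<dots> \<le> lam * (f2 A T lam S * norm e) + f3 A T lam S * norm (y - A *v x)"
    unfolding f2_def f3_def norm_scaleR abs_of_nonneg[OF lam_nonneg]
    by (intro add_mono mult_left_mono norm_mult_vec_le_spec_norm lam_nonneg)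
  finally have "norm (x - ?c) \<le> lam * f2 A T lam S * norm e + f3 A T lam S * norm (y - A *v x)"
    by (simp add: mult_ac)
  with cd show ?thesis
    using norm_triangle_ineq[of "x - ?c" "?c - ?d"] by (simp add: e_def)
qed

end

theorem theorem1:
  fixes A :: "real^'m^'n" and x mu :: "real^'m" and w y :: "real^'n"
    and T \<Delta> :: "'m set" and lam gam :: real
  assumes "CARD('n) < CARD('m)"
    and "y = A *v x + w"
    and "\<Delta> = vsupp x - T"
    and "\<forall>i. i \<notin> T \<longrightarrow> mu $ i = 0"
    and "lam \<ge> 0"
    and "invertible_on (T \<union> \<Delta>) (Q_mat A T lam \<Delta>)"
    and "ERC A T lam \<Delta> > 0"
    and "gam \<ge> gamma_star A y T lam mu \<Delta>"
  shows "\<exists>xhat. is_arg_min (L_fun A y T lam mu gam) (\<lambda>_. True) xhat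
     \<and> (gam > 0 \<longrightarrow> (\<forall>b. is_arg_min (L_fun A y T lam mu gam) (\<lambda>_. True) b \<longrightarrow> b = xhat))
     \<and> xhat = d_min A y T lam mu gam \<Delta>
     \<and> vsupp xhat \<subseteq> T \<union> \<Delta>
     \<and> norm (x - xhat) \<le> gam * sqrt (real (card \<Delta>)) * f1 A T lam \<Delta>
          + lam * f2 A T lam \<Delta> * norm (subvec T x - subvec T mu)
          + f3 A T lam \<Delta> * norm w"
proof -
  interpret regularized_ls A T \<Delta> lam y mu
    by unfold_locales (use assms in auto)
  \<comment> \<open>A nonnegative norm over a positive ERC; this is where nonnegativity of
    \<open>gam\<close> comes from.\<close>
  have "0 \<le> gamma_star A y T lam mu \<Delta>"
    using assms(7) by (simp add: gamma_star_def infnorm_pos_le)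
  with assms(8) have gam: "0 \<le> gam" by simp
  let ?d = "d_min A y T lam mu gam \<Delta>"
  have "L gam ?d \<le> L gam b" for b
    using L_strong_global_min[OF gam assms(7,8), of b] q_nonneg[of "b - ?d"] by simp
  then have "is_arg_min (L gam) (\<lambda>_. True) ?d"
    by (simp add: is_arg_min_def not_less)
  moreover have "subvec (T \<union> \<Delta>) x = x"
    using assms(3) by (auto simp flip: vsupp_subset_iff)
  moreover have "y - A *v x = w"
    using assms(2) by simp
  ultimately show ?thesis
    using global_minimizer_unique[OF _ assms(7,8)] subvec_d_min[OF gam]
      norm_diff_d_min_le[OF gam, of x] by (auto simp: vsupp_subset_iff)
qed

end
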